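(* Let $A$ be a finite simple graph with vertex set $G$, let $B=\{V_1,\dots,V_k\}$ be a partition of $G$ with $n_i=|V_i|\ge 1$, and let $\Gamma_A^B$ be the associated $B$ super$A$ graph. Let $v_i\in V_i$ for $1\le i\le k$ be representatives of the classes, and let $\Delta$ be the induced subgraph of $\Gamma_A^B$ on $\{v_1,\dots,v_k\}$, so that $\Gamma_A^B=\Delta[K_{n_1},\dots,K_{n_k}]$. Assume $\Delta$ is connected. Then the Wiener index of $\Gamma_A^B$ is $$W(\Gamma_A^B)=\sum_{\substack{1\le i\le k\\ n_i>1}}\binom{n_i}{2}+\sum_{1\le i<j\le k}n_in_j\,d_\Delta(v_i,v_j).$$
   Context: All graphs are simple and undirected. The $B$ super$A$ graph $\Gamma_A^B$ has vertex set $G$; distinct $g,h\in G$ are adjacent if and only if either they lie in the same part of $B$, or there exist $g'$ in the part containing $g$ and $h'$ in the part containing $h$ such that $g'$ and $h'$ are adjacent in $A$. $K_n$ is the complete graph on $n$ vertices. Generalized composition: if $\mathcal{H}$ is a graph with vertices labelled $1,\dots,k$ (here $v_i$ is labelled $i$) and $\Gamma_1,\dots,\Gamma_k$ are graphs, then $\mathcal{H}[\Gamma_1,\dots,\Gamma_k]$ has vertex set $V(\Gamma_1)\sqcup\cdots\sqcup V(\Gamma_k)$, with $u\in V(\Gamma_i)$ and $v\in V(\Gamma_j)$ adjacent if and only if either $i=j$ and $u,v$ are adjacent in $\Gamma_i$, or $i\ne j$ and $i,j$ are adjacent in $\mathcal{H}$. $d_\Gamma(u,v)$ is the length of a shortest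 path between $u$ and $v$ in $\Gamma$. The Wiener index $W(\Gamma)$ is the sum of $d_\Gamma(u,v)$ over all unordered pairs of distinct vertices $u,v$ of $\Gamma$. *)

theory Defs
  imports "Graph_Theory.Graph_Theory" "HOL-Library.Disjoint_Sets"
begin

text \<open>
  A finite simple undirected graph is a \<^locale>\<open>pair_graph\<close>: a finite vertex set together with a
  symmetric irreflexive arc relation, each edge being represented by its two orientations.
\<close>

definition super_graph :: "'a pair_pre_digraph \<Rightarrow> 'a set set \<Rightarrow> 'a pair_pre_digraph" where
  "super_graph A B = \<lparr> pverts = pverts A,
     parcs = {(g, h). g \<in> pverts A \<and> h \<in> pverts A \<and> g \<noteq> h \<and>
       ((\<exists>P\<in>B. g \<in> P \<and> h \<in> P) \<or>
        (\<exists>P\<in>B. \<exists>Q\<in>B. g \<in> P \<and> h \<in> Q \<and> (\<exists>g'\<in>P. \<exists>h'\<in>Q. (g', h') \<in> parcs A)))} \<rparr>"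

definition complete_graph :: "nat \<Rightarrow> nat pair_pre_digraph" where
  "complete_graph n = \<lparr> pverts = {1..n}, parcs = {(a, b). a \<in> {1..n} \<and> b \<in> {1..n} \<and> a \<noteq> b} \<rparr>"

lemma complete_digraph_complete_graph: "complete_digraph n (with_proj (complete_graph n))"
  by (auto simp: complete_digraph_pair_def complete_graph_def)

text \<open>
  The vertex of \<open>H\<close> labelled \<open>i\<close>, for \<open>1 \<le> i \<le> k\<close>, is \<open>v i\<close>.
  The disjoint union of the vertex sets is formed by tagging each vertex with its index.
\<close>

definition generalized_composition ::
    "nat \<Rightarrow> (nat \<Rightarrow> 'a) \<Rightarrow> ('a, 'c) pre_digraph \<Rightarrow> (nat \<Rightarrow> 'b pair_pre_digraph) \<Rightarrow>
      (nat \<times> 'b) pair_pre_digraph" where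
  "generalized_composition k v H \<Gamma> = \<lparr> pverts = (SIGMA i:{1..k}. pverts (\<Gamma> i)),
     parcs = {((i, x), (j, y)). i \<in> {1..k} \<and> j \<in> {1..k} \<and> x \<in> pverts (\<Gamma> i) \<and> y \<in> pverts (\<Gamma> j) \<and>
       ((i = j \<and> (x, y) \<in> parcs (\<Gamma> i)) \<or> (i \<noteq> j \<and> v i \<rightarrow>\<^bsub>H\<^esub> v j))} \<rparr>"

text \<open>
  The infimum over a nonempty set of natural numbers is its minimum; if there is no path from
  \<open>u\<close> to \<open>v\<close>, the value is the junk value 0.
\<close>

definition graph_dist :: "('a, 'b) pre_digraph \<Rightarrow> 'a \<Rightarrow> 'a \<Rightarrow> nat" where
  "graph_dist G u v = (INF p\<in>{p. pre_digraph.apath G u p v}. length p)"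

text \<open>
  The sum ranges over the two-element sets of vertices. The description is well defined because
  the distance in a symmetric digraph is symmetric, see \<open>the_graph_dist\<close> below.
\<close>

definition wiener_index :: "('a, 'b) pre_digraph \<Rightarrow> nat" where
  "wiener_index G = (\<Sum>e | e \<subseteq> verts G \<and> card e = 2.
     THE d. \<forall>u v. e = {u, v} \<longrightarrow> d = graph_dist G u v)"

context sym_digraph
begin

lemma awalk_reverse:
  assumes "awalk u p v"
  shows "\<exists>q. awalk v q u \<and> length q = length p \<and> awalk_verts v q = rev (awalk_verts u p)"
  using assms
proof (induction p arbitrary: u)
  case Nil
  then show ?case by (auto simp: awalk_Nil_iff intro!: exI[of _ "[]"])
next
  case (Cons e p)
  then have e: "e \<in> arcs G" "tail G e = u" and p: "awalk (head G e) p v"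
    by (auto simp: awalk_Cons_iff)
  from Cons.IH[OF p] obtain q where q: "awalk v q (head G e)" "length q = length p"
    "awalk_verts v q = rev (awalk_verts (head G e) p)" by blast
  from sym_arcs e obtain f where f: "f \<in> arcs G" "tail G f = head G e" "head G f = u"
    unfolding symmetric_conv by metis
  then have af: "awalk (head G e) [f] u" by (auto simp: awalk_Cons_iff awalk_Nil_iff)
  have "awalk v (q @ [f]) u" using q(1) af by (rule awalk_appendI)
  moreover from this have "awalk_verts v (q @ [f]) = awalk_verts v q @ [u]"
    using f q(1) by (simp add: awalk_verts_append)
  ultimately show ?case
    using q e by (intro exI[of _ "q @ [f]"]) simp
qed

lemma graph_dist_commute: "graph_dist G u v = graph_dist G v u"
proof -
  have "length ` {p. apath u p v} \<subseteq> length ` {p. apath v p u}" for u v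
  proof
    fix l assume "l \<in> length ` {p. apath u p v}"
    then obtain p where p: "apath u p v" "l = length p" by auto
    then obtain q where "awalk v q u" "length q = length p" "awalk_verts v q = rev (awalk_verts u p)"
      using awalk_reverse[of u p v] by (auto simp: apath_def)
    with p show "l \<in> length ` {p. apath v p u}"
      by (auto simp: apath_def intro!: rev_image_eqI[of q])
  qed
  then have "length ` {p. apath u p v} = length ` {p. apath v p u}" by blast
  then show ?thesis by (simp add: graph_dist_def)
qed

lemma the_graph_dist:
  "(THE d. \<forall>x y. {u, v} = {x, y} \<longrightarrow> d = graph_dist G x y) = graph_dist G u v"
  by (rule the_equality) (auto simp: doubleton_eq_iff graph_dist_commute)

end

end

(*
  Sending every vertex to the representative of its class maps walks of the super graph to walks of
  Delta that are no longer. Conversely, a nonempty walk of Delta between two representatives lifts,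
  with the same length, to a walk between any two members of their classes, because adjacency
  between different classes depends only on the classes. So vertices in different classes are at
  the distance of their representatives in Delta, and distinct vertices of one class are adjacent.
  Sorting the pairs of vertices by their classes gives the formula.
*)

theory Submission
  imports Defs
begin

section \<open>Walks and distances in a digraph\<close>

lemma (in wf_digraph) graph_dist_le_length:
  assumes "awalk u p v"
  shows "graph_dist G u v \<le> length p"
proof -
  \<comment> \<open>The distance is an infimum over paths, so a walk bounds it only through a path
    extracted from it. Each extraction step cuts a cycle \<open>r\<close> out of
    \<open>q @ r @ s\<close>, which does not lengthen the walk.\<close>
  have "length (awalk_to_apath p) \<le> length p"
    using assms
  proof (induct rule: awalk_to_apath_induct)
    case (path p)
    then have "awalk_to_apath p = p" by (auto simp: awalk_to_apath.simps)
    then show ?case by simp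
  next
    case (decomp p q r s)
    have "length (q @ s) \<le> length p"
      using decomp by (auto elim!: awalk_cyc_decompE)
    then show ?case
      using decomp step_awalk_to_apath[of u p v q r s] by simp
  qed
  moreover have "graph_dist G u v \<le> length (awalk_to_apath p)"
    unfolding graph_dist_def
    using apath_awalk_to_apath[OF assms] by (intro cINF_lower) auto
  ultimately show ?thesis by simp
qed

text \<open>Reachability makes the set of path lengths nonempty, so its infimum is one of its
  members and not the junk value 0.\<close>

lemma (in wf_digraph) graph_dist_attained:
  assumes "u \<rightarrow>\<^sup>* v"
  obtains p where "awalk u p v" "length p = graph_dist G u v"
proof -
  have "length ` {p. apath u p v} \<noteq> {}"
    using assms by (auto simp: reachable_apath)
  from Inf_nat_def1[OF this] obtain p where "apath u p v" "length p = graph_dist G u v"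
    by (auto simp: graph_dist_def)
  then show thesis by (intro that) (auto simp: apath_def)
qed

lemma (in wf_digraph) graph_dist_pos:
  assumes "u \<rightarrow>\<^sup>* v" "u \<noteq> v"
  shows "graph_dist G u v > 0"
proof -
  obtain p where "awalk u p v" "length p = graph_dist G u v"
    using assms(1) by (rule graph_dist_attained)
  with assms(2) show ?thesis by (cases p) (auto simp: awalk_Nil_iff)
qed

lemma (in wf_digraph) adj_awalk:
  assumes "u \<rightarrow> v"
  obtains p where "awalk u p v" "length p = 1"
proof -
  from assms obtain e where "arc e (u, v)" by (auto simp: arcs_ends_conv arc_def)
  then have "awalk u [e] v" by (auto elim!: arcE intro: arc_implies_awalk)
  then show thesis by (rule that) simp
qed

lemma (in wf_digraph) graph_dist_adj:
  assumes "u \<rightarrow> v" "u \<noteq> v"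
  shows "graph_dist G u v = 1"
proof (rule antisym)
  obtain p where "awalk u p v" "length p = 1" using assms(1) by (rule adj_awalk)
  then show "graph_dist G u v \<le> 1" using graph_dist_le_length by metis
  show "1 \<le> graph_dist G u v"
    using graph_dist_pos[OF reachable_adjI[OF assms(1)] assms(2)] by simp
qed

section \<open>Distances in a graph whose arcs between different fibres of a map are pulled back
  from the image\<close>

locale blow_up = G: wf_digraph G + H: wf_digraph H
  for G :: "('a, 'b) pre_digraph" and H :: "('c, 'd) pre_digraph" +
  fixes f :: "'a \<Rightarrow> 'c"
  assumes image_verts: "f ` verts G = verts H"
    and project_adj: "\<And>u w. u \<rightarrow>\<^bsub>G\<^esub> w \<Longrightarrow> f u = f w \<or> f u \<rightarrow>\<^bsub>H\<^esub> f w"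
    and lift_adj: "\<And>u w. u \<in> verts G \<Longrightarrow> w \<in> verts G \<Longrightarrow> f u \<rightarrow>\<^bsub>H\<^esub> f w \<Longrightarrow> u \<rightarrow>\<^bsub>G\<^esub> w"
begin

text \<open>An arc inside a fibre of \<open>f\<close> disappears and every other arc becomes one arc
  of \<open>H\<close>. The dropped arcs are why there is only an inequality between the
  lengths.\<close>

lemma project_awalk:
  assumes "G.awalk u p w"
  shows "\<exists>q. H.awalk (f u) q (f w) \<and> length q \<le> length p"
  using assms
proof (induction p arbitrary: u)
  case Nil
  then show ?case
    using image_verts by (auto simp: G.awalk_Nil_iff H.awalk_Nil_iff intro!: exI[of _ "[]"])
next
  case (Cons e p)
  then have e: "u \<rightarrow>\<^bsub>G\<^esub> head G e" and p: "G.awalk (head G e) p w"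
    by (auto simp: G.awalk_Cons_iff G.in_arcs_imp_in_arcs_ends)
  obtain q where q: "H.awalk (f (head G e)) q (f w)" "length q \<le> length p"
    using Cons.IH[OF p] by blast
  from project_adj[OF e] show ?case
  proof
    assume "f u = f (head G e)"
    with q show ?thesis by (intro exI[of _ q]) simp
  next
    assume "f u \<rightarrow>\<^bsub>H\<^esub> f (head G e)"
    then obtain r where "H.awalk (f u) r (f (head G e))" "length r = 1"
      by (rule H.adj_awalk)
    with q show ?thesis by (intro exI[of _ "r @ q"]) (auto intro: H.awalk_appendI)
  qed
qed

text \<open>
  The empty walk is excluded because distinct vertices may have the same image.
\<close>

lemma lift_awalk:
  assumes "H.awalk (f u) p (f w)" "p \<noteq> []" "u \<in> verts G" "w \<in> verts G"
  shows "\<exists>q. G.awalk u q w \<and> length q = length p"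
  using assms
proof (induction p arbitrary: u)
  case Nil
  then show ?case by simp
next
  case (Cons e p)
  then have e: "f u \<rightarrow>\<^bsub>H\<^esub> head H e" and p: "H.awalk (head H e) p (f w)"
    by (auto simp: H.awalk_Cons_iff H.in_arcs_imp_in_arcs_ends)
  show ?case
  \<comment> \<open>The induction ends at a single arc, not at the empty walk: both ends
    \<open>u\<close> and \<open>w\<close> are prescribed, and \<open>lift_adj\<close> joins them
    directly.\<close>
  proof (cases "p = []")
    case True
    with p e have "f u \<rightarrow>\<^bsub>H\<^esub> f w" by (simp add: H.awalk_Nil_iff)
    then have "u \<rightarrow>\<^bsub>G\<^esub> w" using Cons.prems lift_adj by blast
    then obtain q where "G.awalk u q w" "length q = 1" by (rule G.adj_awalk)
    then show ?thesis using True by auto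
  next
    case False
    have "head H e \<in> verts H" using p by (rule H.awalk_hd_in_verts)
    \<comment> \<open>Any preimage of the intermediate vertex will do, because
      \<open>lift_adj\<close> holds for all members of the two fibres.\<close>
    then obtain x where x: "x \<in> verts G" "head H e = f x" using image_verts by auto
    obtain q where q: "G.awalk x q w" "length q = length p"
      using Cons.IH[of x] p x False Cons.prems by auto
    obtain r where "G.awalk u r x" "length r = 1"
      using lift_adj[of u x] e x Cons.prems by (auto elim: G.adj_awalk)
    with q show ?thesis by (intro exI[of _ "r @ q"]) (auto intro: G.awalk_appendI)
  qed
qed

text \<open>Lifting a shortest walk of \<open>H\<close> gives one inequality, projecting a shortest
  walk of \<open>G\<close> the other. Different images force the walk in \<open>H\<close> to be
  nonempty, as lifting requires.\<close>

lemma graph_dist_eq: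
  assumes "u \<in> verts G" "w \<in> verts G" "f u \<noteq> f w" "f u \<rightarrow>\<^sup>*\<^bsub>H\<^esub> f w"
  shows "graph_dist G u w = graph_dist H (f u) (f w)"
proof (rule antisym)
  obtain p where p: "H.awalk (f u) p (f w)" "length p = graph_dist H (f u) (f w)"
    using H.graph_dist_attained assms by blast
  then have "p \<noteq> []" using assms by (auto simp: H.awalk_Nil_iff)
  then obtain q where q: "G.awalk u q w" "length q = length p"
    using lift_awalk p assms by blast
  then show "graph_dist G u w \<le> graph_dist H (f u) (f w)"
    using G.graph_dist_le_length p by metis
  \<comment> \<open>The lifted walk also shows that the distance in \<open>G\<close> is attained, so
    that there is a shortest walk to project.\<close>
  have "u \<rightarrow>\<^sup>*\<^bsub>G\<^esub> w" using q by (auto simp: G.reachable_awalk)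
  then obtain p' where "G.awalk u p' w" "length p' = graph_dist G u w"
    using G.graph_dist_attained by blast
  then show "graph_dist H (f u) (f w) \<le> graph_dist G u w"
    using project_awalk H.graph_dist_le_length by (metis le_trans)
qed

end

section \<open>The Wiener index of a graph with classified vertices\<close>

lemma (in sym_digraph) wiener_index_partition:
  fixes c :: "'a \<Rightarrow> 'i::linorder"
  assumes I: "finite I" "c ` verts G \<subseteq> I"
    and fin: "finite (verts G)"
    and V: "\<And>i. i \<in> I \<Longrightarrow> V i = {x \<in> verts G. c x = i}"
    and same: "\<And>u w. u \<in> verts G \<Longrightarrow> w \<in> verts G \<Longrightarrow> c u = c w \<Longrightarrow> u \<noteq> w \<Longrightarrow>
      graph_dist G u w = 1"
    and diff: "\<And>u w. u \<in> verts G \<Longrightarrow> w \<in> verts G \<Longrightarrow> c u < c w \<Longrightarrow>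
      graph_dist G u w = d (c u) (c w)"
  shows "wiener_index G = (\<Sum>i\<in>I. card (V i) choose 2) +
    (\<Sum>(i, j) | i \<in> I \<and> j \<in> I \<and> i < j. card (V i) * card (V j) * d i j)"
proof -
  define D where "D e = (THE d. \<forall>u v. e = {u, v} \<longrightarrow> d = graph_dist G u v)" for e
  have D: "D {u, w} = graph_dist G u w" for u w
    unfolding D_def by (rule the_graph_dist)
  \<comment> \<open>The two-element sets of vertices are split into those inside one class,
    \<open>S i\<close>, and those meeting two classes, \<open>T (i, j)\<close>. Requiring
    \<open>i < j\<close> counts each of the latter once.\<close>
  define J where "J = {(i, j). i \<in> I \<and> j \<in> I \<and> i < j}"
  define S where "S i = {e. e \<subseteq> V i \<and> card e = 2}" for i
  define T where "T = (\<lambda>(i, j). (\<lambda>(x, y). {x, y}) ` (V i \<times> V j))"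
  have finJ: "finite J" by (rule finite_subset[of _ "I \<times> I"]) (auto simp: J_def I)
  have finV: "finite (V i)" if "i \<in> I" for i
    using fin V[OF that] by simp
  have finS: "finite (S i)" if "i \<in> I" for i
    unfolding S_def using finV[OF that] by simp
  have finT: "finite (T ij)" if "ij \<in> J" for ij
    using that finV by (auto simp: T_def J_def)
  have S_iff: "e \<in> S i \<longleftrightarrow> (\<exists>x\<in>verts G. \<exists>y\<in>verts G. e = {x, y} \<and> x \<noteq> y \<and> c x = i \<and> c y = i)"
    if "i \<in> I" for e i
    using V[OF that] by (auto simp: S_def card_2_iff)
  have T_iff: "e \<in> T ij \<longleftrightarrow> (\<exists>x\<in>verts G. \<exists>y\<in>verts G. e = {x, y} \<and> ij = (c x, c y))"
    if "ij \<in> J" for e ij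
    using that V by (fastforce simp: T_def J_def)
  have S_unique: "i = j" if "e \<in> S i" "e \<in> S j" "i \<in> I" "j \<in> I" for e i j
    using that by (auto simp: S_iff doubleton_eq_iff)
  have T_unique: "ij = kl" if "e \<in> T ij" "e \<in> T kl" "ij \<in> J" "kl \<in> J" for e ij kl
  proof -
    \<comment> \<open>Equal doubletons could still match with their elements swapped; the two strict
      inequalities exclude this.\<close>
    have "e \<in> T ij" "e \<in> T kl" "fst ij < snd ij" "fst kl < snd kl"
      using that by (auto simp: J_def)
    then show ?thesis using that by (auto simp: T_iff doubleton_eq_iff)
  qed
  have ST: "(\<Union>i\<in>I. S i) \<inter> (\<Union>ij\<in>J. T ij) = {}"
  proof -
    have "False" if "e \<in> S i" "e \<in> T ij" "i \<in> I" "ij \<in> J" for e i ij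
    proof -
      have "fst ij < snd ij" using that by (auto simp: J_def)
      then show ?thesis using that by (auto simp: S_iff T_iff doubleton_eq_iff)
    qed
    then show ?thesis by blast
  qed
  have "{e. e \<subseteq> verts G \<and> card e = 2} = (\<Union>i\<in>I. S i) \<union> (\<Union>ij\<in>J. T ij)" (is "?L = ?R")
  proof
    show "?L \<subseteq> ?R"
    proof
      fix e assume "e \<in> ?L"
      then obtain x y where e: "e = {x, y}" "x \<noteq> y" "x \<in> verts G" "y \<in> verts G"
        by (auto simp: card_2_iff)
      then have I_xy: "c x \<in> I" "c y \<in> I" using I by auto
      consider "c x = c y" | "c x < c y" | "c y < c x" by force
      then show "e \<in> ?R"
      proof cases
        case 1
        then have "e \<in> S (c x)" using e I_xy by (auto simp: S_iff)
        then show ?thesis using I_xy by blast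
      next
        case 2
        then have J: "(c x, c y) \<in> J" using I_xy by (simp add: J_def)
        then have "e \<in> T (c x, c y)" using e by (auto simp: T_iff)
        then show ?thesis using J by blast
      next
        case 3
        then have J: "(c y, c x) \<in> J" using I_xy by (simp add: J_def)
        then have "e \<in> T (c y, c x)" using e by (auto simp: T_iff insert_commute)
        then show ?thesis using J by blast
      qed
    qed
    show "?R \<subseteq> ?L"
    proof
      fix e assume "e \<in> ?R"
      then consider i where "i \<in> I" "e \<in> S i" | ij where "ij \<in> J" "e \<in> T ij" by blast
      then show "e \<in> ?L"
      proof cases
        case 1
        then show ?thesis by (auto simp: S_iff)
      next
        case 2
        then obtain x y where "x \<in> verts G" "y \<in> verts G" "e = {x, y}" "ij = (c x, c y)"
          by (auto simp: T_iff)
        moreover from this 2 have "x \<noteq> y" by (auto simp: J_def)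
        ultimately show ?thesis by simp
      qed
    qed
  qed
  then have "wiener_index G = sum D ((\<Union>i\<in>I. S i) \<union> (\<Union>ij\<in>J. T ij))"
    by (simp add: wiener_index_def D_def)
  also have "\<dots> = sum D (\<Union>i\<in>I. S i) + sum D (\<Union>ij\<in>J. T ij)"
    using ST I finJ finS finT by (intro sum.union_disjoint) auto
  also have "sum D (\<Union>i\<in>I. S i) = (\<Sum>i\<in>I. sum D (S i))"
    using I(1) finS S_unique by (intro sum.UNION_disjoint) blast+
  also have "\<dots> = (\<Sum>i\<in>I. card (V i) choose 2)"
  proof (rule sum.cong)
    fix i assume i: "i \<in> I"
    have "D e = 1" if "e \<in> S i" for e
    proof -
      from that i obtain x y where "x \<in> verts G" "y \<in> verts G" "e = {x, y}" "x \<noteq> y" "c x = c y"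
        by (auto simp: S_iff)
      then show ?thesis using same by (simp add: D)
    qed
    then have "sum D (S i) = card (S i)" by simp
    also have "\<dots> = card (V i) choose 2" unfolding S_def by (rule n_subsets[OF finV[OF i]])
    finally show "sum D (S i) = card (V i) choose 2" .
  qed simp
  also have "sum D (\<Union>ij\<in>J. T ij) = (\<Sum>ij\<in>J. sum D (T ij))"
    using finJ finT T_unique by (intro sum.UNION_disjoint) blast+
  also have "\<dots> = (\<Sum>(i, j)\<in>J. card (V i) * card (V j) * d i j)"
  proof (rule sum.cong)
    fix ij assume "ij \<in> J"
    then obtain i j where ij: "ij = (i, j)" "i \<in> I" "j \<in> I" "i < j" by (auto simp: J_def)
    \<comment> \<open>The classes \<open>V i\<close> and \<open>V j\<close> are disjoint, so the
      unordered pair determines which element comes from which class.\<close>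
    have "inj_on (\<lambda>(x, y). {x, y}) (V i \<times> V j)"
      using ij V by (auto simp: inj_on_def doubleton_eq_iff)
    then have "sum D (T ij) = (\<Sum>(x, y)\<in>V i \<times> V j. D {x, y})"
      by (simp add: ij(1) T_def sum.reindex case_prod_unfold comp_def)
    also have "\<dots> = (\<Sum>(x, y)\<in>V i \<times> V j. d i j)"
      using ij V diff by (intro sum.cong) (auto simp: D)
    also have "\<dots> = card (V i) * card (V j) * d i j"
      by (simp add: case_prod_unfold card_cartesian_product)
    finally show "sum D (T ij) = (case ij of (i, j) \<Rightarrow> card (V i) * card (V j) * d i j)"
      using ij(1) by simp
  qed simp
  finally show ?thesis by (simp add: J_def)
qed

section \<open>The super graph and its classes\<close>

lemma pair_graph_super_graph:
  assumes "pair_graph A"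
  shows "pair_graph (super_graph A B)"
proof -
  interpret A: pair_graph A by fact
  have "parcs (super_graph A B) \<subseteq> pverts A \<times> pverts A" by (auto simp: super_graph_def)
  then have "finite (parcs (super_graph A B))"
    by (rule finite_subset) (simp add: A.pair_finite_verts)
  moreover have "sym (parcs (super_graph A B))"
  proof (rule symI)
    have sym: "(y, x) \<in> parcs A" if "(x, y) \<in> parcs A" for x y
      using A.sym_arcs that by (auto simp: symmetric_def sym_def)
    show "(y, x) \<in> parcs (super_graph A B)" if "(x, y) \<in> parcs (super_graph A B)" for x y
      using that unfolding super_graph_def by simp (metis sym)
  qed
  ultimately show ?thesis
    by unfold_locales (auto simp: super_graph_def symmetric_def A.pair_finite_verts)
qed

theorem theorem6p3:
  fixes A \<Gamma> :: "'a pair_pre_digraph"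
    and \<Delta> :: "('a, 'a \<times> 'a) pre_digraph"
    and B :: "'a set set"
    and V :: "nat \<Rightarrow> 'a set"
    and v :: "nat \<Rightarrow> 'a"
    and n :: "nat \<Rightarrow> nat"
    and k :: nat
  assumes "pair_graph A"
    and "partition_on (pverts A) B"
    and "bij_betw V {1..k} B"
    and "\<And>i. i \<in> {1..k} \<Longrightarrow> n i = card (V i)"
    and "\<And>i. i \<in> {1..k} \<Longrightarrow> v i \<in> V i"
    and "\<Gamma> = super_graph A B"
    and "\<Delta> = with_proj \<Gamma> \<restriction> (v ` {1..k})"
    and "Digraph_Component.connected \<Delta>"
  shows "digraph_iso (with_proj \<Gamma>)
           (with_proj (generalized_composition k v \<Delta> (\<lambda>i. complete_graph (n i)))) \<and>
         wiener_index (with_proj \<Gamma>) =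
           (\<Sum>i | i \<in> {1..k} \<and> n i > 1. n i choose 2) +
           (\<Sum>(i, j) | 1 \<le> i \<and> i < j \<and> j \<le> k. n i * n j * graph_dist \<Delta> (v i) (v j))"
proof
  note V_bij = assms(3) and n = assms(4) and v = assms(5)
  interpret A: pair_graph A by fact
  interpret G: pair_graph \<Gamma>
    using pair_graph_super_graph[OF assms(1)] assms(6) by simp
  have verts: "pverts \<Gamma> = pverts A" by (simp add: assms(6) super_graph_def)
  have V_in: "V i \<in> B" if "i \<in> {1..k}" for i
    using V_bij that by (auto simp: bij_betw_def)
  have class_unique: "i = j" if "x \<in> V i" "x \<in> V j" "i \<in> {1..k}" "j \<in> {1..k}" for x i j
    using that V_in[of i] V_in[of j] assms(2) V_bij
    by (metis bij_betw_imp_inj_on disjoint_iff inj_on_def partition_onD2 disjointD)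
  have union: "pverts \<Gamma> = (\<Union>i\<in>{1..k}. V i)"
    using V_bij partition_onD1[OF assms(2)] verts by (auto simp: bij_betw_def)
  have finV: "finite (V i)" if "i \<in> {1..k}" for i
    using that union G.pair_finite_verts by (auto intro: finite_subset)
  \<comment> \<open>The label of the class of \<open>x\<close>, well defined on vertices because the
    classes are disjoint and \<open>V\<close> is injective.\<close>
  define c where "c x = (THE i. i \<in> {1..k} \<and> x \<in> V i)" for x
  have c_eq: "c x = i" if "i \<in> {1..k}" "x \<in> V i" for x i
    unfolding c_def using that class_unique by blast
  have c: "c x \<in> {1..k}" "x \<in> V (c x)" if "x \<in> pverts \<Gamma>" for x
    using that union c_eq by auto
  have c_v: "c (v i) = i" if "i \<in> {1..k}" for i
    using that v c_eq by blast
  have in_verts: "x \<in> pverts \<Gamma>" if "i \<in> {1..k}" "x \<in> V i" for i x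
    using that union by blast
  have same_adj: "(x, y) \<in> parcs \<Gamma>" if "x \<in> pverts \<Gamma>" "y \<in> pverts \<Gamma>" "c x = c y" "x \<noteq> y" for x y
    using that c[of x] c[of y] V_in verts by (auto simp: assms(6) super_graph_def)
  \<comment> \<open>Between different classes, adjacency only asks for some arc of \<open>A\<close>
    joining the two parts, so the endpoints may be exchanged within their classes. The condition
    \<open>c x \<noteq> c y\<close> rules out the alternative of a common part and yields
    \<open>x' \<noteq> y'\<close>.\<close>
  have adj_cong: "(x', y') \<in> parcs \<Gamma>"
    if "(x, y) \<in> parcs \<Gamma>" "x' \<in> pverts \<Gamma>" "y' \<in> pverts \<Gamma>" "c x = c x'" "c y = c y'" "c x \<noteq> c y"
    for x y x' y'
  proof -
    have B: "\<exists>i\<in>{1..k}. P = V i" if "P \<in> B" for P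
      using that V_bij by (auto simp: bij_betw_def)
    have "\<exists>P\<in>B. \<exists>Q\<in>B. x \<in> P \<and> y \<in> Q \<and> (\<exists>g'\<in>P. \<exists>h'\<in>Q. (g', h') \<in> parcs A)"
      using that(1,6) B c_eq by (fastforce simp: assms(6) super_graph_def)
    then obtain i j g h where "i \<in> {1..k}" "j \<in> {1..k}" "x \<in> V i" "y \<in> V j"
      "g \<in> V i" "h \<in> V j" "(g, h) \<in> parcs A" using B by metis
    moreover from this have "i = c x'" "j = c y'" using c_eq that by metis+
    ultimately have "x' \<in> V i" "y' \<in> V j" "V i \<in> B" "V j \<in> B" "g \<in> V i" "h \<in> V j"
      "(g, h) \<in> parcs A" using that c V_in by auto
    moreover have "x' \<noteq> y'" using that by auto
    ultimately show ?thesis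
      using that(2,3) verts by (auto simp: assms(6) super_graph_def)
  qed
  have \<Delta>_adj: "x \<rightarrow>\<^bsub>\<Delta>\<^esub> y \<longleftrightarrow> (x, y) \<in> parcs \<Gamma> \<and> x \<in> v ` {1..k} \<and> y \<in> v ` {1..k}" for x y
    by (auto simp: assms(7) arcs_ends_conv image_iff)
  have vc: "v (c x) \<in> pverts \<Gamma>" "c (v (c x)) = c x" if "x \<in> pverts \<Gamma>" for x
    using that c c_v in_verts v by blast+

  \<comment> \<open>The super graph as a generalized composition\<close>
  show "digraph_iso (with_proj \<Gamma>)
    (with_proj (generalized_composition k v \<Delta> (\<lambda>i. complete_graph (n i))))"
  proof -
    \<comment> \<open>The vertices of \<open>complete_graph (n i)\<close> are numbers, so the
      members of each class are numbered; \<open>f\<close> pairs that number with the class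
      label.\<close>
    have "\<exists>\<phi>. bij_betw \<phi> (V i) {1..n i}" if "i \<in> {1..k}" for i
      using that finV n by (simp add: finite_same_card_bij)
    then obtain \<phi> where \<phi>: "bij_betw (\<phi> i) (V i) {1..n i}" if "i \<in> {1..k}" for i
      by metis
    define f where "f x = (c x, \<phi> (c x) x)" for x
    have inj: "inj_on f (pverts \<Gamma>)"
    proof (rule inj_onI)
      fix x y assume "x \<in> pverts \<Gamma>" "y \<in> pverts \<Gamma>" "f x = f y"
      then show "x = y"
        using c[of x] c[of y] inj_onD[OF bij_betw_imp_inj_on[OF \<phi>[of "c x"]], of x y]
        by (auto simp: f_def)
    qed
    have img: "f ` pverts \<Gamma> = (SIGMA i:{1..k}. {1..n i})"
    proof
      show "f ` pverts \<Gamma> \<subseteq> (SIGMA i:{1..k}. {1..n i})"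
        using c bij_betwE[OF \<phi>] by (auto simp: f_def)
      show "(SIGMA i:{1..k}. {1..n i}) \<subseteq> f ` pverts \<Gamma>"
      proof clarify
        fix i a assume "i \<in> {1..k}" "a \<in> {1..n i}"
        moreover from this have "a \<in> \<phi> i ` V i"
          using \<phi>[of i] by (simp add: bij_betw_def)
        then obtain x where "x \<in> V i" "a = \<phi> i x" by blast
        ultimately show "(i, a) \<in> f ` pverts \<Gamma>"
          using c_eq in_verts by (auto simp: f_def intro!: rev_image_eqI[of x])
      qed
    qed
    let ?C = "generalized_composition k v \<Delta> (\<lambda>i. complete_graph (n i))"
    have pvC: "pverts ?C = (SIGMA i:{1..k}. {1..n i})"
      by (simp add: generalized_composition_def complete_graph_def)
    have arc_iff: "(f x, f y) \<in> parcs ?C \<longleftrightarrow> (x, y) \<in> parcs \<Gamma>"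
      if xy: "x \<in> pverts \<Gamma>" "y \<in> pverts \<Gamma>" for x y
    proof -
      have f: "c x \<in> {1..k}" "c y \<in> {1..k}" "\<phi> (c x) x \<in> {1..n (c x)}" "\<phi> (c y) y \<in> {1..n (c y)}"
        using xy c bij_betwE[OF \<phi>] by blast+
      have "f x = f y \<longleftrightarrow> x = y" using inj xy by (auto dest: inj_onD)
      then have "(f x, f y) \<in> parcs ?C \<longleftrightarrow>
          c x = c y \<and> x \<noteq> y \<or> c x \<noteq> c y \<and> (v (c x), v (c y)) \<in> parcs \<Gamma>"
        using f by (auto simp: f_def generalized_composition_def complete_graph_def \<Delta>_adj)
      \<comment> \<open>Within a class, \<open>same_adj\<close> and the absence of loops decide.
        Across classes, \<open>adj_cong\<close> is used in both directions, from the vertices to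
        their representatives and back.\<close>
      also have "\<dots> \<longleftrightarrow> (x, y) \<in> parcs \<Gamma>"
        using xy same_adj[of x y] adj_cong[of x y "v (c x)" "v (c y)"]
          adj_cong[of "v (c x)" "v (c y)" x y] vc[of x] vc[of y] G.pair_no_loops[of "(x, y)"]
        by auto
      finally show ?thesis .
    qed
    have arcs: "map_prod f f ` parcs \<Gamma> = parcs ?C"
    proof
      show "map_prod f f ` parcs \<Gamma> \<subseteq> parcs ?C"
        using arc_iff G.in_arcsD1 G.in_arcsD2 by auto
      show "parcs ?C \<subseteq> map_prod f f ` parcs \<Gamma>"
      proof
        fix e assume e: "e \<in> parcs ?C"
        then have "fst e \<in> pverts ?C" "snd e \<in> pverts ?C"
          by (auto simp: generalized_composition_def)
        then obtain x y where "x \<in> pverts \<Gamma>" "y \<in> pverts \<Gamma>" "e = (f x, f y)"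
          unfolding pvC img[symmetric] by (metis imageE prod.collapse)
        with e arc_iff show "e \<in> map_prod f f ` parcs \<Gamma>" by force
      qed
    qed
    \<comment> \<open>Arcs are ordered pairs of their ends, so acting by \<open>f\<close> on both
      components keeps \<open>fst\<close> and \<open>snd\<close> as tail and head.\<close>
    let ?h = "\<lparr> iso_verts = f, iso_arcs = map_prod f f, iso_head = snd, iso_tail = fst \<rparr>"
    have "inj_on (map_prod f f) (parcs \<Gamma>)"
      by (rule inj_on_subset[OF map_prod_inj_on[OF inj inj]])
        (auto dest: G.in_arcsD1 G.in_arcsD2)
    then have "pre_digraph.digraph_isomorphism (with_proj \<Gamma>) ?h"
      using inj G.wf_digraph_axioms by (simp add: pre_digraph.digraph_isomorphism_def)
    moreover have "with_proj ?C = app_iso ?h (with_proj \<Gamma>)"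
      by (simp add: app_iso_def with_proj_def arcs img pvC)
    ultimately show ?thesis unfolding digraph_iso_def by blast
  qed

  \<comment> \<open>Distances in the super graph and its Wiener index\<close>
  interpret D: wf_digraph \<Delta> unfolding assms(7) by (rule G.wellformed_induce_subgraph)
  interpret D: sym_digraph \<Delta>
  proof unfold_locales
    have "sym (parcs \<Gamma>)" using G.sym_arcs by (simp add: symmetric_def)
    then show "symmetric \<Delta>"
      unfolding symmetric_def by (intro symI) (auto simp: \<Delta>_adj dest: symD)
  qed
  \<comment> \<open>The fibres of \<open>v \<circ> c\<close> are the classes, since \<open>c\<close>
    recovers the label from the representative.\<close>
  interpret blow_up "with_proj \<Gamma>" \<Delta> "v \<circ> c"
  proof unfold_locales
    show "(v \<circ> c) ` verts (with_proj \<Gamma>) = verts \<Delta>"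
    proof -
      have "c ` pverts \<Gamma> = {1..k}"
      proof
        show "c ` pverts \<Gamma> \<subseteq> {1..k}" using c by blast
        show "{1..k} \<subseteq> c ` pverts \<Gamma>"
          using c_v in_verts v by (metis imageI subsetI)
      qed
      then have "v ` c ` pverts \<Gamma> = v ` {1..k}" by simp
      then show ?thesis by (simp add: assms(7) image_image)
    qed
  next
    fix x y assume "x \<rightarrow>\<^bsub>with_proj \<Gamma>\<^esub> y"
    then have xy: "(x, y) \<in> parcs \<Gamma>" "x \<in> pverts \<Gamma>" "y \<in> pverts \<Gamma>"
      using G.in_arcsD1 G.in_arcsD2 by auto
    then show "(v \<circ> c) x = (v \<circ> c) y \<or> (v \<circ> c) x \<rightarrow>\<^bsub>\<Delta>\<^esub> (v \<circ> c) y"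
      using adj_cong[of x y "v (c x)" "v (c y)"] vc[of x] vc[of y] c[of x] c[of y]
      by (cases "c x = c y") (auto simp: \<Delta>_adj)
  next
    fix x y assume xy: "x \<in> verts (with_proj \<Gamma>)" "y \<in> verts (with_proj \<Gamma>)"
      and "(v \<circ> c) x \<rightarrow>\<^bsub>\<Delta>\<^esub> (v \<circ> c) y"
    then have arc: "(v (c x), v (c y)) \<in> parcs \<Gamma>" by (auto simp: \<Delta>_adj)
    \<comment> \<open>With equal labels the arc would be a loop at the common
      representative.\<close>
    then have "c x \<noteq> c y" using G.pair_no_loops by fastforce
    then show "x \<rightarrow>\<^bsub>with_proj \<Gamma>\<^esub> y"
      using adj_cong[OF arc, of x y] xy vc by simp
  qed
  have dist: "graph_dist (with_proj \<Gamma>) x y = graph_dist \<Delta> (v (c x)) (v (c y))"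
    if xy: "x \<in> pverts \<Gamma>" "y \<in> pverts \<Gamma>" "c x < c y" for x y
  proof -
    have "v (c x) \<noteq> v (c y)" using xy vc by (metis less_irrefl)
    \<comment> \<open>Connectedness refers to the symmetric closure of the arcs; as \<Delta> is
      symmetric already, it gives directed walks between all representatives.\<close>
    moreover have "v (c x) \<rightarrow>\<^sup>*\<^bsub>\<Delta>\<^esub> v (c y)"
      using D.symmetric_connected_imp_strongly_connected[OF D.sym_arcs assms(8)] xy c
      by (auto simp: strongly_connected_def assms(7))
    ultimately show ?thesis
      using graph_dist_eq[of x y] xy by simp
  qed
  have "wiener_index (with_proj \<Gamma>) = (\<Sum>i\<in>{1..k}. card (V i) choose 2) +
    (\<Sum>(i, j) | i \<in> {1..k} \<and> j \<in> {1..k} \<and> i < j.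
      card (V i) * card (V j) * graph_dist \<Delta> (v i) (v j))"
  proof (rule G.wiener_index_partition[where c = c])
    show "c ` pverts \<Gamma> \<subseteq> {1..k}" using c by auto
    show "V i = {x \<in> pverts \<Gamma>. c x = i}" if "i \<in> {1..k}" for i
      using that c c_eq in_verts by auto
    show "graph_dist (with_proj \<Gamma>) x y = 1"
      if "x \<in> pverts \<Gamma>" "y \<in> pverts \<Gamma>" "c x = c y" "x \<noteq> y" for x y
      using that same_adj[of x y] by (intro G.graph_dist_adj) auto
    show "graph_dist (with_proj \<Gamma>) x y = graph_dist \<Delta> (v (c x)) (v (c y))"
      if "x \<in> pverts \<Gamma>" "y \<in> pverts \<Gamma>" "c x < c y" for x y
      using that dist by simp
  qed (simp_all add: G.pair_finite_verts)
  \<comment> \<open>The classes left out on the right have at most one element and contribute a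
    binomial coefficient equal to 0.\<close>
  also have "(\<Sum>i\<in>{1..k}. card (V i) choose 2) = (\<Sum>i | i \<in> {1..k} \<and> n i > 1. n i choose 2)"
    by (rule sum.mono_neutral_cong_right) (auto simp: n binomial_eq_0)
  also have "(\<Sum>(i, j) | i \<in> {1..k} \<and> j \<in> {1..k} \<and> i < j.
      card (V i) * card (V j) * graph_dist \<Delta> (v i) (v j)) =
    (\<Sum>(i, j) | 1 \<le> i \<and> i < j \<and> j \<le> k. n i * n j * graph_dist \<Delta> (v i) (v j))"
    by (rule sum.cong) (auto simp: n)
  finally show "wiener_index (with_proj \<Gamma>) =
      (\<Sum>i | i \<in> {1..k} \<and> n i > 1. n i choose 2) +
      (\<Sum>(i, j) | 1 \<le> i \<and> i < j \<and> j \<le> k. n i * n j * graph_dist \<Delta> (v i) (v j))" .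
qed

end
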